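(* Let $d,d'\ge 2$ be integers. Using one $dd'$-box, Alice and Bob can exactly simulate one $d$-box.
   Context: For an integer $d\ge 2$, a $d$-box is the bipartite non-signalling box with inputs $X,Y\in\{0,1\}$ and outputs $a,b\in\{0,\ldots,d-1\}$ with joint output probabilities $p_{ab|XY}=1/d$ if $(b-a)\bmod d=X\cdot Y$ and $p_{ab|XY}=0$ otherwise. Here $X$ (input) and $a$ (output) belong to Alice, $Y$ and $b$ to Bob. Simulation using one box with probabilities $q_{\alpha\beta|xy}$ (no communication): Alice, given her global input $X$, chooses the input $x$ to her side of the box as a function of $X$, receives the output $\alpha$, and produces her final output $a$ as a function of $X$ and $\alpha$; Bob, given $Y$, does likewise with $y$, $\beta$, $b$. The pair $(\alpha,\beta)$ occurs with probability $q_{\alpha\beta|xy}$. The parties may also choose these functions according to local and shared random data that is independent of the global inputs. The box exactly simulates a target box if some such protocol yields, for every pair of global inputs, final outputs $(a,b)$ distributed exactly as the target box prescribes. *)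

theory Defs
  imports "HOL-Probability.Probability"
begin

text \<open>A bipartite box: finite input and output alphabets of the two parties, and
  \<open>prob P a b X Y\<close> is the probability of the outputs \<open>(a, b)\<close> given the inputs \<open>(X, Y)\<close>.
  Only the values on the alphabets are meaningful.\<close>

record box =
  inputsA :: "nat set"
  inputsB :: "nat set"
  outputsA :: "nat set"
  outputsB :: "nat set"
  prob :: "nat \<Rightarrow> nat \<Rightarrow> nat \<Rightarrow> nat \<Rightarrow> real"

definition d_box :: "nat \<Rightarrow> box" where
  "d_box d = \<lparr>
     inputsA = {0, 1}, inputsB = {0, 1},
     outputsA = {0..<d}, outputsB = {0..<d},
     prob = (\<lambda>a b X Y. if (int b - int a) mod int d = int (X * Y) then 1 / real d else 0)\<rparr>"

text \<open>A protocol using one box once.  The shared datum \<open>s\<close> and the local data \<open>r\<close> (Alice) and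
  \<open>t\<close> (Bob) are drawn independently of each other and of the global inputs.  Alice feeds
  \<open>chooseA s r X\<close> into the box and turns its output \<open>\<alpha>\<close> into \<open>finalA s r X \<alpha>\<close>; Bob does
  likewise with \<open>t\<close> and \<open>Y\<close>.\<close>

record ('s, 'r, 't) protocol =
  shared :: "'s pmf"
  localA :: "'r pmf"
  localB :: "'t pmf"
  chooseA :: "'s \<Rightarrow> 'r \<Rightarrow> nat \<Rightarrow> nat"
  chooseB :: "'s \<Rightarrow> 't \<Rightarrow> nat \<Rightarrow> nat"
  finalA :: "'s \<Rightarrow> 'r \<Rightarrow> nat \<Rightarrow> nat \<Rightarrow> nat"
  finalB :: "'s \<Rightarrow> 't \<Rightarrow> nat \<Rightarrow> nat \<Rightarrow> nat"

definition valid_protocol :: "box \<Rightarrow> box \<Rightarrow> ('s, 'r, 't) protocol \<Rightarrow> bool" where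
  "valid_protocol Q P \<pi> \<longleftrightarrow>
     (\<forall>s r. \<forall>X\<in>inputsA P. chooseA \<pi> s r X \<in> inputsA Q \<and>
        (\<forall>\<alpha>\<in>outputsA Q. finalA \<pi> s r X \<alpha> \<in> outputsA P)) \<and>
     (\<forall>s t. \<forall>Y\<in>inputsB P. chooseB \<pi> s t Y \<in> inputsB Q \<and>
        (\<forall>\<beta>\<in>outputsB Q. finalB \<pi> s t Y \<beta> \<in> outputsB P))"

definition final_prob ::
  "box \<Rightarrow> ('s, 'r, 't) protocol \<Rightarrow> nat \<Rightarrow> nat \<Rightarrow> nat \<Rightarrow> nat \<Rightarrow> real" where
  "final_prob Q \<pi> a b X Y =
     measure_pmf.expectation (pair_pmf (shared \<pi>) (pair_pmf (localA \<pi>) (localB \<pi>)))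
       (\<lambda>(s, r, t). \<Sum>\<alpha>\<in>outputsA Q. \<Sum>\<beta>\<in>outputsB Q.
          if finalA \<pi> s r X \<alpha> = a \<and> finalB \<pi> s t Y \<beta> = b
          then prob Q \<alpha> \<beta> (chooseA \<pi> s r X) (chooseB \<pi> s t Y) else 0)"

text \<open>Random data are discrete and encoded as natural numbers.  This loses nothing for finite
  alphabets: there are finitely many choice functions, so any random data act as a finite
  mixture of deterministic strategies.\<close>

definition exactly_simulates :: "box \<Rightarrow> box \<Rightarrow> bool" where
  "exactly_simulates Q P \<longleftrightarrow>
     (\<exists>\<pi> :: (nat, nat, nat) protocol. valid_protocol Q P \<pi> \<and>
        (\<forall>X\<in>inputsA P. \<forall>Y\<in>inputsB P. \<forall>a\<in>outputsA P. \<forall>b\<in>outputsB P.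
           final_prob Q \<pi> a b X Y = prob P a b X Y))"

end

(* Reducing both outputs of the dd'-box modulo d already works: b - a = X Y modulo dd' implies the
   same congruence modulo d, and each residue modulo d has exactly d' representatives below dd'. *)
theory Submission
  imports Defs
begin

text \<open>Pass the inputs through unchanged and reduce both outputs modulo \<open>d\<close>. For
  each \<open>\<alpha>\<close> below \<open>d * d'\<close> the large box allows exactly one
  \<open>\<beta>\<close>, namely \<open>\<alpha>\<close> + \<open>X * Y\<close> modulo
  \<open>d * d'\<close>, with weight 1/(\<open>d * d'\<close>). Since \<open>d\<close> divides
  \<open>d * d'\<close>, the reduced outputs satisfy the relation of the \<open>d\<close>-box. Each
  residue \<open>a\<close> has exactly \<open>d'\<close> representatives \<open>\<alpha>\<close>, so
  each allowed pair gets probability 1/\<open>d\<close>.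
  \<open>card_residue_class_below_mult\<close> does the counting and
  \<open>sum_d_box_reduced_outputs\<close> the whole computation.\<close>

text \<open>Solves the box condition for Bob's output, so that a sum over his outputs has at most
  one nonzero term.\<close>

lemma int_diff_mod_eq_iff:
  fixes x y k n :: nat
  assumes "y < n" "k < n"
  shows "(int y - int x) mod int n = int k \<longleftrightarrow> y = (x + k) mod n"
proof -
  have "(int y - int x) mod int n = int k \<longleftrightarrow> (int y - int x) mod int n = int k mod int n"
    using assms by simp
  also have "\<dots> \<longleftrightarrow> int n dvd (int y - int x - int k)"
    by (rule mod_eq_dvd_iff)
  also have "\<dots> \<longleftrightarrow> int n dvd (int y - int (x + k))"
    by (simp add: algebra_simps)
  also have "\<dots> \<longleftrightarrow> int y mod int n = int (x + k) mod int n"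
    by (simp only: mod_eq_dvd_iff)
  also have "\<dots> \<longleftrightarrow> y = (x + k) mod n"
    using assms(1) by (metis mod_less of_nat_eq_iff zmod_int)
  finally show ?thesis .
qed

text \<open>Division with remainder: \<open>x = k * d + a\<close>, where the quotient
  \<open>k\<close> runs freely below \<open>m\<close>.\<close>

lemma card_residue_class_below_mult:
  fixes a d m :: nat
  assumes "a < d"
  shows "card {x. x < d * m \<and> x mod d = a} = m"
proof -
  have "{x. x < d * m \<and> x mod d = a} = (\<lambda>k. k * d + a) ` {..<m}" (is "?L = ?R")
  proof (intro equalityI subsetI)
    fix x assume "x \<in> ?L"
    then show "x \<in> ?R"
      by (intro image_eqI[of _ _ "x div d"]) (auto simp: less_mult_imp_div_less mult.commute)
  next
    fix x assume "x \<in> ?R"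
    then obtain k where k: "k < m" "x = k * d + a" by auto
    have "x < Suc k * d" using k(2) assms by simp
    also have "\<dots> \<le> m * d" using k(1) by (intro mult_le_mono1) simp
    finally show "x \<in> ?L" using k(2) assms by (simp add: mult.commute)
  qed
  moreover have "inj_on (\<lambda>k. k * d + a) {..<m}"
    using assms by (auto simp: inj_on_def)
  ultimately show ?thesis by (simp add: card_image)
qed

text \<open>The double sum is the output distribution of the deterministic protocol. As
  \<open>X * Y < d\<close>, the product is its own residue for both moduli.\<close>

lemma sum_d_box_reduced_outputs:
  fixes a b d m X Y :: nat
  assumes "a < d" "b < d" "X * Y < d" "0 < m"
  shows "(\<Sum>\<alpha><d * m. \<Sum>\<beta><d * m.
            if \<alpha> mod d = a \<and> \<beta> mod d = b then prob (d_box (d * m)) \<alpha> \<beta> X Y else 0)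
         = prob (d_box d) a b X Y"
proof -
  let ?N = "d * m" and ?k = "X * Y"
  have k: "?k < ?N"
    using assms(3,4) by (metis One_nat_def Suc_leI less_le_trans mult.right_neutral mult_le_mono2)
  have "(\<Sum>\<beta><?N. if \<alpha> mod d = a \<and> \<beta> mod d = b then prob (d_box ?N) \<alpha> \<beta> X Y else 0)
        = (if \<alpha> mod d = a \<and> b = (a + ?k) mod d then 1 / real ?N else 0)" for \<alpha>
  proof -
    have "(\<Sum>\<beta><?N. if \<alpha> mod d = a \<and> \<beta> mod d = b then prob (d_box ?N) \<alpha> \<beta> X Y else 0)
          = (\<Sum>\<beta><?N. if \<beta> = (\<alpha> + ?k) mod ?N
               then (if \<alpha> mod d = a \<and> \<beta> mod d = b then 1 / real ?N else 0) else 0)"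
      using k by (intro sum.cong)
        (auto simp: d_box_def int_diff_mod_eq_iff simp del: of_nat_mult)
    also have "\<dots> = (if \<alpha> mod d = a \<and> (\<alpha> + ?k) mod ?N mod d = b then 1 / real ?N else 0)"
      using assms by (subst sum.delta) auto
    \<comment> \<open>Reducing modulo \<open>?N\<close> first is harmless because \<open>d\<close>
      divides \<open>?N\<close>; then \<open>\<alpha>\<close> may be replaced by its residue
      \<open>a\<close>.\<close>
    also have "\<dots> = (if \<alpha> mod d = a \<and> b = (a + ?k) mod d then 1 / real ?N else 0)"
      by (auto simp: mod_mod_cancel mod_add_left_eq)
    finally show ?thesis .
  qed
  then have "(\<Sum>\<alpha><?N. \<Sum>\<beta><?N.
            if \<alpha> mod d = a \<and> \<beta> mod d = b then prob (d_box ?N) \<alpha> \<beta> X Y else 0)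
        = (\<Sum>\<alpha><?N. if \<alpha> mod d = a then (if b = (a + ?k) mod d then 1 / real ?N else 0) else 0)"
    by (intro sum.cong) auto
  also have "\<dots> = (\<Sum>\<alpha> | \<alpha> < ?N \<and> \<alpha> mod d = a. if b = (a + ?k) mod d then 1 / real ?N else 0)"
    by (subst sum.inter_filter[symmetric]) auto
  \<comment> \<open>There are \<open>m\<close> equal terms 1/(\<open>d * m\<close>), and
    \<open>m\<close> cancels since it is positive.\<close>
  also have "\<dots> = (if b = (a + ?k) mod d then 1 / real d else 0)"
    using assms by (simp add: card_residue_class_below_mult)
  also have "\<dots> = prob (d_box d) a b X Y"
    using assms by (simp add: d_box_def int_diff_mod_eq_iff del: of_nat_mult)
  finally show ?thesis .
qed

theorem mainTheorem7:
  fixes d d' :: nat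
  assumes "d \<ge> 2" and "d' \<ge> 2"
  shows "exactly_simulates (d_box (d * d')) (d_box d)"
proof -
  define \<pi> :: "(nat, nat, nat) protocol" where
    "\<pi> = \<lparr>shared = return_pmf 0, localA = return_pmf 0, localB = return_pmf 0,
          chooseA = (\<lambda>_ _ X. X), chooseB = (\<lambda>_ _ Y. Y),
          finalA = (\<lambda>_ _ _ \<alpha>. \<alpha> mod d), finalB = (\<lambda>_ _ _ \<beta>. \<beta> mod d)\<rparr>"
  have "valid_protocol (d_box (d * d')) (d_box d) \<pi>"
    using assms by (auto simp: valid_protocol_def \<pi>_def d_box_def)
  moreover have "final_prob (d_box (d * d')) \<pi> a b X Y = prob (d_box d) a b X Y"
    if "X \<in> {0, 1}" "Y \<in> {0, 1}" "a < d" "b < d" for X Y a b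
  proof -
    \<comment> \<open>A product of bits is at most 1, and \<open>d\<close> is at least 2.\<close>
    have "X * Y < d" using that assms by auto
    moreover have "outputsA (d_box n) = {..<n}" "outputsB (d_box n) = {..<n}" for n
      by (auto simp: d_box_def)
    ultimately show ?thesis
      using sum_d_box_reduced_outputs[of a d b X Y d'] that assms
      by (simp add: final_prob_def \<pi>_def pair_return_pmf1 cong: if_cong)
  qed
  ultimately show ?thesis
    unfolding exactly_simulates_def by (intro exI[of _ \<pi>]) (simp add: d_box_def)
qed

end
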